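(* Let an $(\overline{n},\overline{k})$ MSR code over $\mathbf{F}_q$ (the base code) with sub-packetization level $N$, repair degree $\overline{d}<\overline{n}-1$, parity-check matrix $(\overline{A}_{t,i})_{t\in[0:r),i\in[0:\overline{n})}$ ($r=\overline{n}-\overline{k}$), repair matrices $\overline{R}_{i,j}$ and select matrices $\overline{S}_{i,t}$ be given, let $s\ge2$, $n=s\overline{n}$, $k=n-r$, $d=n-\overline{n}+\overline{d}$, $d_c=s-1$, and consider the new $(n,k)$ array code over $\mathbf{F}_q$, with its matrices $A_{t,j},R_{i,j},S_{i,t}$, obtained from the base code by the generic transformation. Suppose that the base code satisfies R1 and R2 and the new code satisfies R3 (all defined in the context). Then the new code has the $(d,d_c)$-repair property, where the compulsory helper nodes for node $i$ are the $s-1$ nodes $j\neq i$ with $j\equiv i \bmod \overline{n}$, and it has $\bigl(1+\frac{d_c(d-k)}{d}\bigr)$-optimal repair bandwidth; that is, for every $i\in[0:n)$ and every $d$-subset $H_i\subseteq[0:n)\setminus\{i\}$ containing all compulsory helper nodes of $i$, the content $\mathbf{f}_i$ can be recovered from the downloaded data $R_{i,j}\mathbf{f}_j$, $j\in H_i$, with repair bandwidth $$\gamma_i=\sum_{j\in H_i}\operatorname{rank}(R_{i,j})\le\Bigl(1+\frac{d_c(d-k)}{d}\Bigr)\frac{d}{d-k+1}N .$$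
   Context: Notation: $[a:b)=\{a,a+1,\dots,b-1\}$; $\%$ is the modulo operation; $I_N$ is the $N\times N$ identity matrix. Array codes: an $(n,k)$ array code over $\mathbf{F}_q$ with sub-packetization level $N$ and parity-check matrix $(A_{t,i})_{t\in[0:r),i\in[0:n)}$ ($r=n-k$, each $A_{t,i}$ an $N\times N$ matrix) is the set of $(\mathbf{f}_0,\dots,\mathbf{f}_{n-1})$, $\mathbf{f}_i\in\mathbf{F}_q^N$ column vectors (node $i$ stores $\mathbf{f}_i$), with $\sum_{i=0}^{n-1}A_{t,i}\mathbf{f}_i=0$ for all $t\in[0:r)$. It is MDS if any $k$ nodes determine the codeword. An MSR code with repair degree $\overline d$ is an MDS array code in which any node can be repaired from any $\overline d$ other nodes by downloading in total $\frac{\overline d}{\overline d-\overline k+1}N$ symbols. Base code: its repair matrices $\overline{R}_{i,j}$ ($i,j\in[0:\overline{n})$, $j\ne i$) and select matrices $\overline{S}_{i,t}$ ($t\in[0:r)$) are $\frac{N}{\overline{d}-\overline{k}+1}\times N$ matrices of full rank. Generic transformation: with $x_{t,j}\in\mathbf{F}_q\setminus\{0\}$, the new code has $A_{t,j}=x_{t,j}\overline{A}_{t,j\%\overline{n}}$; $R_{i,j}=\overline{R}_{i\%\overline{n},j\%\overline{n}}$ if $j\not\equiv i\bmod\overline{n}$ and $R_{i,j}=I_N$ otherwise; $S_{i,t}=\overline{S}_{i\%\overline{n},t}$; for $t\in[0:r)$, $i,j\in[0:n)$, $j\ne i$ (in $A_{t,j}$, $j$ is arbitrary). Requirements. R1 (base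 code): for every $i\in[0:\overline n)$, the matrix obtained by stacking $\overline{S}_{i,0}\overline{A}_{0,i},\dots,\overline{S}_{i,r-1}\overline{A}_{r-1,i}$ has rank $N$. R2 (base code): for all $i\neq j$ in $[0:\overline n)$ and $t\in[0:r)$, $\operatorname{rank}\begin{pmatrix}\overline{R}_{i,j}\\ \overline{S}_{i,t}\overline{A}_{t,j}\end{pmatrix}=\operatorname{rank}(\overline{R}_{i,j})$. R3 (new code): for every $i\in[0:n)$, every $d$-subset $H_i\subseteq[0:n)\setminus\{i\}$ containing all $j\ne i$ with $j\equiv i\bmod\overline n$, and every $l\in L_i=[0:n)\setminus(H_i\cup\{i\})$, there is a function $\phi_{i,l}$ with $R_{i,l}\mathbf{f}_l=\phi_{i,l}(R_{i,j}\mathbf{f}_j, j\in H_i)$ for all codewords. $(d,d_c)$-repair property: any failed node can be repaired by downloading data from $d$ helper nodes, where some $d_c$ helper nodes (depending on the failed node) are compulsory and the remaining $d-d_c$ can be chosen arbitrarily. *)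

theory Defs
  imports Complex_Main "HOL-Library.FuncSet" "Jordan_Normal_Form.DL_Rank"
begin

definition mat_rank :: "'a::field mat \<Rightarrow> nat" where
  "mat_rank A = vec_space.rank (dim_row A) A"

definition stack_mats :: "nat \<Rightarrow> 'a mat list \<Rightarrow> 'a mat" where
  "stack_mats N Ms = mat_of_rows N (concat (map rows Ms))"

text \<open>Codewords are extensional functions on \<open>{0..<n}\<close>; the content of node \<open>i\<close> is \<open>f i\<close>.
  The first index of \<open>A\<close> is the number of the parity-check equation, the second one is the node.\<close>

definition array_code ::
  "nat \<Rightarrow> nat \<Rightarrow> nat \<Rightarrow> (nat \<Rightarrow> nat \<Rightarrow> 'a::field mat) \<Rightarrow> (nat \<Rightarrow> 'a vec) set" where
  "array_code n r N A =
     {f \<in> {0..<n} \<rightarrow>\<^sub>E carrier_vec N.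
        \<forall>t<r. finsum_vec TYPE('a) N (\<lambda>i. A t i *\<^sub>v f i) {0..<n} = 0\<^sub>v N}"

text \<open>On the code \<open>C\<close>, the quantity \<open>h f\<close> is a function of the data \<open>g j (f j)\<close> that the
  nodes \<open>j \<in> H\<close> compute from their contents.\<close>

definition determined_by ::
  "(nat \<Rightarrow> 'a vec) set \<Rightarrow> nat set \<Rightarrow> (nat \<Rightarrow> 'a vec \<Rightarrow> 'a vec) \<Rightarrow> ((nat \<Rightarrow> 'a vec) \<Rightarrow> 'b) \<Rightarrow> bool" where
  "determined_by C H g h \<longleftrightarrow> (\<exists>\<phi>. \<forall>f\<in>C. h f = \<phi> (\<lambda>j\<in>H. g j (f j)))"

definition MDS_code :: "nat \<Rightarrow> nat \<Rightarrow> (nat \<Rightarrow> 'a vec) set \<Rightarrow> bool" where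
  "MDS_code n k C \<longleftrightarrow> (\<forall>K\<subseteq>{0..<n}. card K = k \<longrightarrow> determined_by C K (\<lambda>j v. v) (\<lambda>f. f))"

definition opt_bandwidth :: "nat \<Rightarrow> nat \<Rightarrow> nat \<Rightarrow> real" where
  "opt_bandwidth k d N = real d / (real d - real k + 1) * real N"

text \<open>Here \<open>\<beta> j\<close> is the number of symbols downloaded from the helper node \<open>j\<close>.\<close>

definition MSR_code :: "nat \<Rightarrow> nat \<Rightarrow> nat \<Rightarrow> nat \<Rightarrow> (nat \<Rightarrow> 'a vec) set \<Rightarrow> bool" where
  "MSR_code n k N d C \<longleftrightarrow>
     k \<le> d \<and> d < n \<and> MDS_code n k C \<and>
     (\<forall>i<n. \<forall>H\<subseteq>{0..<n} - {i}. card H = d \<longrightarrow>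
        (\<exists>g \<beta>. (\<forall>j\<in>H. \<forall>v\<in>carrier_vec N. g j v \<in> carrier_vec (\<beta> j)) \<and>
               real (\<Sum>j\<in>H. \<beta> j) = opt_bandwidth k d N \<and>
               determined_by C H g (\<lambda>f. f i)))"

text \<open>The matrices \<open>R i j\<close> describe an optimal repair of the code \<open>C\<close>: node \<open>i\<close> is repaired
  from the data \<open>R i j *\<^sub>v f j\<close> of any \<open>d\<close> helper nodes \<open>j\<close>.\<close>

definition MSR_repair_matrices ::
  "nat \<Rightarrow> nat \<Rightarrow> nat \<Rightarrow> nat \<Rightarrow> (nat \<Rightarrow> 'a::field vec) set \<Rightarrow> (nat \<Rightarrow> nat \<Rightarrow> 'a mat) \<Rightarrow> bool" where
  "MSR_repair_matrices n k N d C R \<longleftrightarrow>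
     (\<forall>i<n. \<forall>j<n. j \<noteq> i \<longrightarrow>
        R i j \<in> carrier_mat (N div (d - k + 1)) N \<and> mat_rank (R i j) = N div (d - k + 1)) \<and>
     (\<forall>i<n. \<forall>H\<subseteq>{0..<n} - {i}. card H = d \<longrightarrow>
        determined_by C H (\<lambda>j v. R i j *\<^sub>v v) (\<lambda>f. f i))"

definition MSR_select_matrices ::
  "nat \<Rightarrow> nat \<Rightarrow> nat \<Rightarrow> nat \<Rightarrow> nat \<Rightarrow> (nat \<Rightarrow> nat \<Rightarrow> 'a::field mat) \<Rightarrow> bool" where
  "MSR_select_matrices n k r N d S \<longleftrightarrow>
     (\<forall>i<n. \<forall>t<r.
        S i t \<in> carrier_mat (N div (d - k + 1)) N \<and> mat_rank (S i t) = N div (d - k + 1))"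

text \<open>The generic transformation, where \<open>nb\<close> is the length of the base code.\<close>

definition new_A ::
  "nat \<Rightarrow> (nat \<Rightarrow> nat \<Rightarrow> 'a::field) \<Rightarrow> (nat \<Rightarrow> nat \<Rightarrow> 'a mat) \<Rightarrow> nat \<Rightarrow> nat \<Rightarrow> 'a mat" where
  "new_A nb x A t j = x t j \<cdot>\<^sub>m A t (j mod nb)"

definition new_R ::
  "nat \<Rightarrow> nat \<Rightarrow> (nat \<Rightarrow> nat \<Rightarrow> 'a::field mat) \<Rightarrow> nat \<Rightarrow> nat \<Rightarrow> 'a mat" where
  "new_R nb N R i j = (if j mod nb \<noteq> i mod nb then R (i mod nb) (j mod nb) else 1\<^sub>m N)"

definition new_S :: "nat \<Rightarrow> (nat \<Rightarrow> nat \<Rightarrow> 'a::field mat) \<Rightarrow> nat \<Rightarrow> nat \<Rightarrow> 'a mat" where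
  "new_S nb S i t = S (i mod nb) t"

definition compulsory :: "nat \<Rightarrow> nat \<Rightarrow> nat \<Rightarrow> nat set" where
  "compulsory nb n i = {j \<in> {0..<n}. j \<noteq> i \<and> j mod nb = i mod nb}"

definition R1 ::
  "nat \<Rightarrow> nat \<Rightarrow> nat \<Rightarrow> (nat \<Rightarrow> nat \<Rightarrow> 'a::field mat) \<Rightarrow> (nat \<Rightarrow> nat \<Rightarrow> 'a mat) \<Rightarrow> bool" where
  "R1 nb r N A S \<longleftrightarrow>
     (\<forall>i<nb. mat_rank (stack_mats N (map (\<lambda>t. S i t * A t i) [0..<r])) = N)"

definition R2 ::
  "nat \<Rightarrow> nat \<Rightarrow> nat \<Rightarrow> (nat \<Rightarrow> nat \<Rightarrow> 'a::field mat) \<Rightarrow> (nat \<Rightarrow> nat \<Rightarrow> 'a mat) \<Rightarrow>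
   (nat \<Rightarrow> nat \<Rightarrow> 'a mat) \<Rightarrow> bool" where
  "R2 nb r N A R S \<longleftrightarrow>
     (\<forall>i<nb. \<forall>j<nb. i \<noteq> j \<longrightarrow>
        (\<forall>t<r. mat_rank (stack_mats N [R i j, S i t * A t j]) = mat_rank (R i j)))"

definition R3 ::
  "nat \<Rightarrow> nat \<Rightarrow> nat \<Rightarrow> (nat \<Rightarrow> 'a::field vec) set \<Rightarrow> (nat \<Rightarrow> nat \<Rightarrow> 'a mat) \<Rightarrow> bool" where
  "R3 nb n d C R \<longleftrightarrow>
     (\<forall>i<n. \<forall>H\<subseteq>{0..<n} - {i}. card H = d \<and> compulsory nb n i \<subseteq> H \<longrightarrow>
        (\<forall>l\<in>{0..<n} - (H \<union> {i}).
           determined_by C H (\<lambda>j v. R i j *\<^sub>v v) (\<lambda>f. R i l *\<^sub>v f l)))"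

text \<open>The \<open>(d,dc)\<close>-repair property with \<open>cs i\<close> as the set of compulsory helper nodes of
  node \<open>i\<close>. It does not restrict the amount of downloaded data.\<close>

definition repair_property ::
  "nat \<Rightarrow> nat \<Rightarrow> nat \<Rightarrow> (nat \<Rightarrow> nat set) \<Rightarrow> (nat \<Rightarrow> 'a vec) set \<Rightarrow> bool" where
  "repair_property n d dc cs C \<longleftrightarrow>
     (\<forall>i<n. cs i \<subseteq> {0..<n} - {i} \<and> card (cs i) = dc \<and>
        (\<forall>H\<subseteq>{0..<n} - {i}. card H = d \<and> cs i \<subseteq> H \<longrightarrow>
           (\<exists>g. determined_by C H g (\<lambda>f. f i))))"

definition has_optimal_repair_bandwidth ::
  "real \<Rightarrow> nat \<Rightarrow> nat \<Rightarrow> nat \<Rightarrow> nat \<Rightarrow> (nat \<Rightarrow> nat set) \<Rightarrow> (nat \<Rightarrow> 'a::field vec) set \<Rightarrow>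
   (nat \<Rightarrow> nat \<Rightarrow> 'a mat) \<Rightarrow> bool" where
  "has_optimal_repair_bandwidth c n k N d cs C R \<longleftrightarrow>
     (\<forall>i<n. \<forall>H\<subseteq>{0..<n} - {i}. card H = d \<and> cs i \<subseteq> H \<longrightarrow>
        determined_by C H (\<lambda>j v. R i j *\<^sub>v v) (\<lambda>f. f i) \<and>
        real (\<Sum>j\<in>H. mat_rank (R i j)) \<le> c * opt_bandwidth k d N)"

end

theory Submission
  imports Defs "Jordan_Normal_Form.Matrix_Kernel"
begin

text \<open>By linearity it suffices to compare two codewords with the same downloaded data. R3 makes
  them agree after multiplication by \<open>R i l\<close> at the non-helper nodes \<open>l\<close> too. Multiply the
  \<open>t\<close>-th parity-check equation by \<open>S i t\<close>. By rank-nullity, R2 says that the kernel of \<open>R i j\<close>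
  is contained in that of \<open>S i t * A t j\<close>, so nodes outside the residue class of \<open>i\<close> contribute
  equally to both codewords, and so do the compulsory nodes, which are downloaded entirely. Hence
  the contributions of node \<open>i\<close> agree for every \<open>t\<close>, and R1 makes \<open>f i\<close> unique.
  The bandwidth bound holds with equality.\<close>

section \<open>Rank and kernel of a matrix\<close>

text \<open>Makes the rank-nullity theorem for abstract linear maps applicable to concrete
  matrices.\<close>

lemma linear_map_mult_mat_vec:
  fixes M :: "'a::field mat"
  assumes M: "M \<in> carrier_mat nr nc"
  shows "linear_map class_ring (module_vec TYPE('a) nc) (module_vec TYPE('a) nr) (\<lambda>v. M *\<^sub>v v)"
proof -
  have "(\<lambda>v. M *\<^sub>v v) \<in>
      LinearCombinations.module_hom class_ring (module_vec TYPE('a) nc) (module_vec TYPE('a) nr)"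
    unfolding LinearCombinations.module_hom_def
    using mult_mat_vec_carrier[OF M] mult_add_distrib_mat_vec[OF M] mult_mat_vec[OF M]
    by (simp add: module_vec_simps)
  thus ?thesis
    by (intro linear_map.intro mod_hom.intro mod_hom_axioms.intro vec_vs vec_module)
qed

text \<open>Rank-nullity for the map given by \<open>M\<close>: its image is the span of the
  columns, whose dimension is the rank, and its kernel is \<open>mat_kernel M\<close>.\<close>

lemma mat_rank_plus_kernel_dim:
  fixes M :: "'a::field mat"
  assumes M: "M \<in> carrier_mat nr nc"
  shows "mat_rank M + kernel_dim M = nc"
proof -
  interpret V: vec_space "TYPE('a)" nc .
  interpret W: vec_space "TYPE('a)" nr .
  interpret L: linear_map class_ring "module_vec TYPE('a) nc" "module_vec TYPE('a) nr" "\<lambda>v. M *\<^sub>v v"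
    by (rule linear_map_mult_mat_vec[OF M])
  have "L.im = W.span (set (cols M))"
    using W.col_space_eq[OF M] M
    unfolding L.im_def W.col_space_def by (auto simp: module_vec_simps)
  moreover have "L.ker = mat_kernel M"
    using M unfolding L.ker_def mat_kernel_def by (auto simp: module_vec_simps)
  ultimately show ?thesis
    using L.rank_nullity[OF V.fin_dim] M
    unfolding mat_rank_def kernel_dim_def V.dim_is_n carrier_matD[OF M] W.rank_def by simp
qed

text \<open>As both matrices have \<open>nc\<close> columns, equal ranks give kernels of equal
  dimension, whatever the numbers of rows. A basis of the smaller kernel is then an independent set
  of full size in the larger one, hence a basis of it too.\<close>

lemma mat_kernel_eqI:
  fixes M M' :: "'a::field mat"
  assumes M: "M \<in> carrier_mat nr nc" and M': "M' \<in> carrier_mat nr' nc"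
    and sub: "mat_kernel M \<subseteq> mat_kernel M'" and rank: "mat_rank M = mat_rank M'"
  shows "mat_kernel M = mat_kernel M'"
proof -
  interpret K: kernel nr nc M by unfold_locales (rule M)
  interpret K': kernel nr' nc M' by unfold_locales (rule M')
  have dim: "K.dim = K'.dim"
    using mat_rank_plus_kernel_dim[OF M] mat_rank_plus_kernel_dim[OF M'] rank by simp
  obtain B where B: "finite B" "K.basis B"
    using kernel_basis_exists[OF M] by blast
  have BM: "B \<subseteq> mat_kernel M" and li: "K.lin_indpt B" and span: "K.span B = mat_kernel M"
    using B(2) by (simp_all add: K.Ker.basis_def)
  have card: "card B = K.dim"
    using K.Ker.dim_basis[OF B] by simp
  obtain B' where B': "finite B'" "K'.basis B'"
    using kernel_basis_exists[OF M'] by blast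
  have fin: "K'.Ker.fin_dim"
    using B' unfolding K'.Ker.fin_dim_def K'.Ker.basis_def by auto
  have BM': "B \<subseteq> mat_kernel M'" using BM sub by blast
  \<comment> \<open>Independence inside either kernel is the same as independence in the ambient
    space, so it passes from one kernel to the other.\<close>
  have "K'.lin_indpt B"
    using li K.lindep_same[OF BM] K'.lindep_same[OF BM'] by simp
  hence "K'.basis B"
    using K'.Ker.dim_li_is_basis[OF fin B(1)] BM' card dim by simp
  hence "K'.span B = mat_kernel M'" by (simp add: K'.Ker.basis_def)
  thus ?thesis
    using span K.span_same[OF BM] K'.span_same[OF BM'] by simp
qed

lemma mat_rank_one: "mat_rank (1\<^sub>m N :: 'a::field mat) = N"
  using vec_space.det_rank_iff[of "1\<^sub>m N :: 'a mat" N] by (simp add: mat_rank_def)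

lemma stack_mats_carrier: "stack_mats N Ms \<in> carrier_mat (length (concat (map rows Ms))) N"
  by (simp add: stack_mats_def mat_of_rows_def)

lemma mat_kernel_iff_rows:
  fixes M :: "'a::field mat"
  assumes M: "M \<in> carrier_mat nr nc"
  shows "v \<in> mat_kernel M \<longleftrightarrow> v \<in> carrier_vec nc \<and> (\<forall>w\<in>set (rows M). w \<bullet> v = 0)"
  using M by (auto simp: mat_kernel[OF M] rows_def vec_eq_iff)

text \<open>Kernel membership is tested row by row, and the rows of the stack are those of its
  blocks. The separate carrier condition covers the empty list, whose stack has the whole space as
  kernel.\<close>

lemma mat_kernel_stack_mats:
  fixes Ms :: "'a::field mat list"
  assumes Ms: "\<And>M. M \<in> set Ms \<Longrightarrow> dim_col M = N"
  shows "v \<in> mat_kernel (stack_mats N Ms) \<longleftrightarrow>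
    v \<in> carrier_vec N \<and> (\<forall>M\<in>set Ms. v \<in> mat_kernel M)"
proof -
  have sub: "set (concat (map rows Ms)) \<subseteq> carrier_vec N"
    using Ms by (fastforce simp: rows_def)
  have "rows (stack_mats N Ms) = concat (map rows Ms)"
    unfolding stack_mats_def by (rule rows_mat_of_rows[OF sub])
  hence rows: "set (rows (stack_mats N Ms)) = (\<Union>M\<in>set Ms. set (rows M))" by simp
  have "v \<in> mat_kernel M \<longleftrightarrow> v \<in> carrier_vec N \<and> (\<forall>w\<in>set (rows M). w \<bullet> v = 0)" if "M \<in> set Ms" for M
    using mat_kernel_iff_rows[of M "dim_row M" N v] Ms[OF that] by auto
  thus ?thesis
    unfolding mat_kernel_iff_rows[OF stack_mats_carrier] rows by auto
qed

text \<open>Turns the rank condition R2 into a kernel inclusion. The kernel of the stack is the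
  intersection of the two kernels; equality of ranks forces this intersection to be all of
  \<open>mat_kernel P\<close>.\<close>

lemma mat_kernel_stack_absorb:
  fixes P Q :: "'a::field mat"
  assumes P: "P \<in> carrier_mat p N" and Q: "Q \<in> carrier_mat q N"
    and rank: "mat_rank (stack_mats N [P, Q]) = mat_rank P"
  shows "mat_kernel P \<subseteq> mat_kernel Q"
proof -
  have ker: "v \<in> mat_kernel (stack_mats N [P, Q]) \<longleftrightarrow> v \<in> mat_kernel P \<and> v \<in> mat_kernel Q" for v
    using mat_kernel_stack_mats[of "[P, Q]" N v] P Q mat_kernel_carrier[OF P] by auto
  have "mat_kernel (stack_mats N [P, Q]) = mat_kernel P"
    by (rule mat_kernel_eqI[OF stack_mats_carrier P _ rank]) (use ker in blast)
  thus ?thesis using ker by blast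
qed

text \<open>Comparison with the identity matrix, which has the same rank and whose trivial kernel
  lies in every kernel.\<close>

lemma mat_kernel_full_rank:
  fixes M :: "'a::field mat"
  assumes M: "M \<in> carrier_mat nr nc" and rank: "mat_rank M = nc"
  shows "mat_kernel M = {0\<^sub>v nc}"
proof -
  have one: "mat_kernel (1\<^sub>m nc :: 'a mat) = {0\<^sub>v nc}"
    by (auto simp: mat_kernel[of _ nc nc])
  have "mat_kernel (1\<^sub>m nc) = mat_kernel M"
    by (rule mat_kernel_eqI[OF one_carrier_mat M])
      (use M in \<open>auto simp: one rank mat_rank_one mat_kernel[OF M]\<close>)
  thus ?thesis using one by simp
qed

lemma minus_in_mat_kernel_iff:
  fixes M :: "'a::field mat"
  assumes M: "M \<in> carrier_mat nr nc" and "v \<in> carrier_vec nc" "w \<in> carrier_vec nc"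
  shows "v - w \<in> mat_kernel M \<longleftrightarrow> M *\<^sub>v v = M *\<^sub>v w"
proof -
  have "M *\<^sub>v (v - w) = M *\<^sub>v v - M *\<^sub>v w"
    using assms by (simp add: mult_minus_distrib_mat_vec)
  thus ?thesis
    using assms by (auto simp: mat_kernel[OF M] vec_eq_iff)
qed

section \<open>Parity-check equations\<close>

lemma mult_mat_vec_finsum_vec:
  fixes P :: "'a::field mat"
  assumes P: "P \<in> carrier_mat m N" and fin: "finite F" and u: "u \<in> F \<rightarrow> carrier_vec N"
  shows "P *\<^sub>v finsum_vec TYPE('a) N u F = finsum_vec TYPE('a) m (\<lambda>j. P *\<^sub>v u j) F"
  using fin u
proof (induction F)
  case empty
  then show ?case using P by (auto simp: finsum_vec_empty vec_eq_iff)
next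
  case (insert j F)
  hence u: "u \<in> F \<rightarrow> carrier_vec N" "u j \<in> carrier_vec N" by auto
  have "P *\<^sub>v finsum_vec TYPE('a) N u (insert j F) = P *\<^sub>v (u j + finsum_vec TYPE('a) N u F)"
    by (subst finsum_vec_insert) (use insert.hyps u in auto)
  also have "\<dots> = P *\<^sub>v u j + finsum_vec TYPE('a) m (\<lambda>j. P *\<^sub>v u j) F"
    using insert.IH u P finsum_vec_closed[OF u(1)] by (simp add: mult_add_distrib_mat_vec)
  also have "\<dots> = finsum_vec TYPE('a) m (\<lambda>j. P *\<^sub>v u j) (insert j F)"
    by (subst finsum_vec_insert)
      (use insert.hyps u mult_mat_vec_carrier[OF P] in \<open>auto simp: Pi_iff\<close>)
  finally show ?case .
qed

lemma finsum_vec_cong: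
  fixes u v :: "'b \<Rightarrow> 'a::field vec"
  assumes "v \<in> F \<rightarrow> carrier_vec N" and "\<And>j. j \<in> F \<Longrightarrow> u j = v j"
  shows "finsum_vec TYPE('a) N u F = finsum_vec TYPE('a) N v F"
  using comm_monoid.finprod_cong'[OF comm_monoid_vec refl, folded finsum_vec_def,
      unfolded monoid_vec_simps, OF assms] .

lemma finsum_vec_remove:
  fixes u :: "'b \<Rightarrow> 'a::field vec"
  assumes "finite F" and "i \<in> F" and "u \<in> F \<rightarrow> carrier_vec N"
  shows "finsum_vec TYPE('a) N u F = u i + finsum_vec TYPE('a) N u (F - {i})"
proof -
  have "F = insert i (F - {i})" using assms(2) by blast
  moreover have "finsum_vec TYPE('a) N u (insert i (F - {i})) = u i + finsum_vec TYPE('a) N u (F - {i})"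
    by (rule finsum_vec_insert) (use assms in auto)
  ultimately show ?thesis by simp
qed

text \<open>Multiplied by \<open>P\<close>, the parity-check sums of both codewords still vanish,
  and all their terms except the one at \<open>i\<close> coincide. So the terms at \<open>i\<close>
  coincide as well.\<close>

lemma parity_check_isolate:
  fixes A :: "nat \<Rightarrow> nat \<Rightarrow> 'a::field mat"
  assumes A: "\<And>j. j < n \<Longrightarrow> A t j \<in> carrier_mat N N"
    and P: "P \<in> carrier_mat m N" and t: "t < r" and i: "i < n"
    and f: "f \<in> array_code n r N A" and f': "f' \<in> array_code n r N A"
    and eq: "\<And>j. j < n \<Longrightarrow> j \<noteq> i \<Longrightarrow> (P * A t j) *\<^sub>v f j = (P * A t j) *\<^sub>v f' j"
  shows "(P * A t i) *\<^sub>v f i = (P * A t i) *\<^sub>v f' i"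
proof -
  define w where "w g j = (P * A t j) *\<^sub>v g j" for g :: "nat \<Rightarrow> 'a vec" and j
  have iso: "w g i + finsum_vec TYPE('a) m (w g) ({0..<n} - {i}) = 0\<^sub>v m"
    and w: "w g \<in> {0..<n} \<rightarrow> carrier_vec m" if g: "g \<in> array_code n r N A" for g
  proof -
    have car: "g j \<in> carrier_vec N" if "j < n" for j
      using g that by (auto simp: array_code_def)
    have wj: "w g j = P *\<^sub>v (A t j *\<^sub>v g j)" if "j < n" for j
      using assoc_mult_mat_vec[OF P A[OF that] car[OF that]] by (simp add: w_def)
    have u: "(\<lambda>j. A t j *\<^sub>v g j) \<in> {0..<n} \<rightarrow> carrier_vec N"
      using mult_mat_vec_carrier[OF A car] by simp
    show w: "w g \<in> {0..<n} \<rightarrow> carrier_vec m"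
      using wj mult_mat_vec_carrier[OF P] u by (simp add: Pi_iff)
    have "finsum_vec TYPE('a) m (w g) {0..<n} =
        finsum_vec TYPE('a) m (\<lambda>j. P *\<^sub>v (A t j *\<^sub>v g j)) {0..<n}"
      by (rule finsum_vec_cong) (use wj w in \<open>simp_all add: Pi_iff\<close>)
    also have "\<dots> = P *\<^sub>v finsum_vec TYPE('a) N (\<lambda>j. A t j *\<^sub>v g j) {0..<n}"
      by (rule mult_mat_vec_finsum_vec[OF P _ u, symmetric]) simp
    also have "\<dots> = 0\<^sub>v m"
    proof -
      have "finsum_vec TYPE('a) N (\<lambda>j. A t j *\<^sub>v g j) {0..<n} = 0\<^sub>v N"
        using g t by (simp add: array_code_def)
      moreover have "P *\<^sub>v 0\<^sub>v N = 0\<^sub>v m" using P by (auto simp: vec_eq_iff)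
      ultimately show ?thesis by simp
    qed
    finally show "w g i + finsum_vec TYPE('a) m (w g) ({0..<n} - {i}) = 0\<^sub>v m"
      using finsum_vec_remove[OF _ _ w, of i] i by simp
  qed
  have w': "w f' \<in> {0..<n} - {i} \<rightarrow> carrier_vec m"
    using w[OF f'] by auto
  have rest: "finsum_vec TYPE('a) m (w f) ({0..<n} - {i}) = finsum_vec TYPE('a) m (w f') ({0..<n} - {i})"
    by (rule finsum_vec_cong[OF w']) (simp add: w_def eq)
  have "w f i = w f' i"
  proof (rule eq_vecI)
    fix p assume "p < dim_vec (w f' i)"
    moreover have dim: "dim_vec (w f i) = m" "dim_vec (w f' i) = m"
      using w[OF f] w[OF f'] i by (auto simp: Pi_iff)
    \<comment> \<open>Entrywise, both values are the negative of the same entry of the remaining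
      sum.\<close>
    ultimately show "w f i $ p = w f' i $ p"
      using arg_cong[OF iso[OF f], of "\<lambda>v. v $ p"] arg_cong[OF iso[OF f'], of "\<lambda>v. v $ p"]
        finsum_vec_closed[OF w'] unfolding rest by (simp add: eq_neg_iff_add_eq_0[symmetric])
  qed (use w[OF f] w[OF f'] i in \<open>force simp: Pi_iff\<close>)
  thus ?thesis by (simp add: w_def)
qed

text \<open>Trades the decoding function for a comparison of two codewords with equal data, so that
  no decoder has to be constructed in the repair argument.\<close>

lemma determined_by_iff:
  "determined_by C H g h \<longleftrightarrow>
    (\<forall>f\<in>C. \<forall>f'\<in>C. (\<forall>j\<in>H. g j (f j) = g j (f' j)) \<longrightarrow> h f = h f')"
proof
  assume "determined_by C H g h"
  then obtain \<phi> where \<phi>: "\<And>f. f \<in> C \<Longrightarrow> h f = \<phi> (\<lambda>j\<in>H. g j (f j))"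
    unfolding determined_by_def by blast
  show "\<forall>f\<in>C. \<forall>f'\<in>C. (\<forall>j\<in>H. g j (f j) = g j (f' j)) \<longrightarrow> h f = h f'"
  proof (intro ballI impI)
    fix f f' assume f: "f \<in> C" "f' \<in> C" and "\<forall>j\<in>H. g j (f j) = g j (f' j)"
    hence "(\<lambda>j\<in>H. g j (f j)) = (\<lambda>j\<in>H. g j (f' j))" by (intro restrict_ext) blast
    thus "h f = h f'" using \<phi> f by simp
  qed
next
  assume inj: "\<forall>f\<in>C. \<forall>f'\<in>C. (\<forall>j\<in>H. g j (f j) = g j (f' j)) \<longrightarrow> h f = h f'"
  \<comment> \<open>The decoder picks any codeword with the given data; \<open>inj\<close> makes the
    choice irrelevant. On data that no codeword produces its value is arbitrary.\<close>
  define \<phi> where "\<phi> y = h (SOME f. f \<in> C \<and> (\<lambda>j\<in>H. g j (f j)) = y)" for y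
  have "h f = \<phi> (\<lambda>j\<in>H. g j (f j))" if "f \<in> C" for f
  proof -
    define f' where "f' = (SOME f'. f' \<in> C \<and> (\<lambda>j\<in>H. g j (f' j)) = (\<lambda>j\<in>H. g j (f j)))"
    have "f' \<in> C \<and> (\<lambda>j\<in>H. g j (f' j)) = (\<lambda>j\<in>H. g j (f j))"
      unfolding f'_def by (rule someI[of _ f]) (simp add: that)
    moreover from this have "\<forall>j\<in>H. g j (f' j) = g j (f j)"
      by (auto dest!: fun_cong split: if_splits)
    ultimately have "h f' = h f" using inj that by blast
    thus ?thesis by (simp add: \<phi>_def f'_def)
  qed
  thus "determined_by C H g h" unfolding determined_by_def by blast
qed

section \<open>Compulsory helper nodes\<close>

text \<open>Parametrizing the class by the quotient makes its size visible: one element for each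
  \<open>q\<close> below \<open>s\<close>.\<close>

lemma residue_class_eq_image:
  fixes nb :: nat
  assumes "nb > 0"
  shows "{j \<in> {0..<s * nb}. j mod nb = i mod nb} = (\<lambda>q. q * nb + i mod nb) ` {0..<s}"
proof (rule equalityI; rule subsetI)
  fix j assume j: "j \<in> {j \<in> {0..<s * nb}. j mod nb = i mod nb}"
  hence "j = (j div nb) * nb + i mod nb"
    using div_mult_mod_eq[of j nb] by simp
  moreover have "j div nb < s"
    using j by (simp add: less_mult_imp_div_less)
  ultimately show "j \<in> (\<lambda>q. q * nb + i mod nb) ` {0..<s}" by (intro image_eqI) simp_all
next
  fix j assume "j \<in> (\<lambda>q. q * nb + i mod nb) ` {0..<s}"
  then obtain q where q: "q < s" "j = q * nb + i mod nb" by auto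
  have "j < Suc q * nb" using q(2) assms by simp
  also have "\<dots> \<le> s * nb" using q(1) by (intro mult_le_mono1) simp
  finally show "j \<in> {j \<in> {0..<s * nb}. j mod nb = i mod nb}" using q(2) by simp
qed

lemma card_compulsory:
  assumes nb: "nb > 0" and i: "i < s * nb"
  shows "card (compulsory nb (s * nb) i) = s - 1"
proof -
  have "inj_on (\<lambda>q. q * nb + i mod nb) {0..<s}"
    using nb by (auto intro: inj_onI)
  hence "card {j \<in> {0..<s * nb}. j mod nb = i mod nb} = s"
    unfolding residue_class_eq_image[OF nb] by (simp add: card_image)
  moreover have "compulsory nb (s * nb) i = {j \<in> {0..<s * nb}. j mod nb = i mod nb} - {i}"
    by (auto simp: compulsory_def)
  ultimately show ?thesis using i by simp
qed

text \<open>The \<open>s - 1\<close> compulsory helpers send their full content through an identity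
  matrix; each other helper lies in a different residue class and costs the base rank
  \<open>\<beta>\<close>.\<close>

lemma sum_mat_rank_new_R:
  assumes nb: "nb > 0" and n: "n = s * nb" and i: "i < n"
    and H: "H \<subseteq> {0..<n} - {i}" "card H = d" "compulsory nb n i \<subseteq> H"
    and R: "\<And>i j. i < nb \<Longrightarrow> j < nb \<Longrightarrow> j \<noteq> i \<Longrightarrow> mat_rank (R i j) = \<beta>"
  shows "(\<Sum>j\<in>H. mat_rank (new_R nb N R i j)) = (s - 1) * N + (d - (s - 1)) * \<beta>"
proof -
  let ?K = "compulsory nb n i"
  have fin: "finite H" using H(1) finite_subset by blast
  have K: "card ?K = s - 1" "finite ?K"
    using card_compulsory[OF nb, of i s] i n finite_subset[OF H(3) fin] by simp_all
  have "(\<Sum>j\<in>?K. mat_rank (new_R nb N R i j)) = (\<Sum>j\<in>?K. N)"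
    by (rule sum.cong) (auto simp: compulsory_def new_R_def mat_rank_one)
  moreover have "(\<Sum>j\<in>H - ?K. mat_rank (new_R nb N R i j)) = (\<Sum>j\<in>H - ?K. \<beta>)"
    by (rule sum.cong) (use H(1) nb in \<open>auto simp: compulsory_def new_R_def intro!: R\<close>)
  moreover have "card (H - ?K) = d - (s - 1)"
    using card_Diff_subset[OF K(2) H(3)] K(1) H(2) by simp
  ultimately show ?thesis
    using sum.subset_diff[OF H(3) fin, of "\<lambda>j. mat_rank (new_R nb N R i j)"] K(1) by simp
qed

section \<open>Repair of the new code\<close>

lemma new_code_repair:
  fixes A R S :: "nat \<Rightarrow> nat \<Rightarrow> 'a::field mat"
  assumes nb: "nb > 0"
    and A: "\<And>t i. t < r \<Longrightarrow> i < nb \<Longrightarrow> A t i \<in> carrier_mat N N"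
    and R: "\<And>i j. i < nb \<Longrightarrow> j < nb \<Longrightarrow> j \<noteq> i \<Longrightarrow> R i j \<in> carrier_mat \<beta> N"
    and S: "\<And>i t. i < nb \<Longrightarrow> t < r \<Longrightarrow> S i t \<in> carrier_mat \<sigma> N"
    and x: "\<And>t j. t < r \<Longrightarrow> j < n \<Longrightarrow> x t j \<noteq> 0"
    and R1: "R1 nb r N A S"
    and R2: "R2 nb r N A R S"
    and R3: "R3 nb n d (array_code n r N (new_A nb x A)) (new_R nb N R)"
    and i: "i < n" and H: "H \<subseteq> {0..<n} - {i}" "card H = d" "compulsory nb n i \<subseteq> H"
  shows "determined_by (array_code n r N (new_A nb x A)) H
    (\<lambda>j v. new_R nb N R i j *\<^sub>v v) (\<lambda>f. f i)"
  unfolding determined_by_iff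
proof (intro ballI impI)
  let ?C = "array_code n r N (new_A nb x A)"
  fix f f' assume f: "f \<in> ?C" and f': "f' \<in> ?C"
    and data: "\<forall>j\<in>H. new_R nb N R i j *\<^sub>v f j = new_R nb N R i j *\<^sub>v f' j"
  let ?i = "i mod nb"
  have ib: "?i < nb" using nb by simp
  have car: "f j \<in> carrier_vec N" "f' j \<in> carrier_vec N" if "j < n" for j
    using f f' that by (auto simp: array_code_def)
  \<comment> \<open>R3 extends the agreement from the helpers to every surviving node.\<close>
  have all: "new_R nb N R i j *\<^sub>v f j = new_R nb N R i j *\<^sub>v f' j" if "j < n" "j \<noteq> i" for j
  proof (cases "j \<in> H")
    case False
    with that have "j \<in> {0..<n} - (H \<union> {i})" by simp
    hence "determined_by ?C H (\<lambda>j v. new_R nb N R i j *\<^sub>v v) (\<lambda>f. new_R nb N R i j *\<^sub>v f j)"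
      using R3 i H unfolding R3_def by blast
    thus ?thesis using f f' data unfolding determined_by_iff by blast
  qed (use data in blast)
  have nA: "new_A nb x A t j \<in> carrier_mat N N" if "t < r" for t j
    using A[OF that, of "j mod nb"] nb by (simp add: new_A_def)
  have mult: "S ?i t * new_A nb x A t j = x t j \<cdot>\<^sub>m (S ?i t * A t (j mod nb))" if "t < r" for t j
    unfolding new_A_def
    by (rule mult_smult_distrib[OF S[OF ib that] A[OF that]]) (use nb in simp)
  have SA: "S ?i t * A t (j mod nb) \<in> carrier_mat \<sigma> N" if "t < r" for t j
    using S[OF ib that] A[OF that, of "j mod nb"] nb by simp
  have smult: "(x t j \<cdot>\<^sub>m (S ?i t * A t (j mod nb))) *\<^sub>v v = x t j \<cdot>\<^sub>v ((S ?i t * A t (j mod nb)) *\<^sub>v v)"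
    if "t < r" "v \<in> carrier_vec N" for t j v
    by (rule eq_vecI) (use SA[OF that(1), of j] that(2) in \<open>auto simp: scalar_prod_smult_left\<close>)
  have zero: "f i - f' i \<in> mat_kernel (S ?i t * A t ?i)" if t: "t < r" for t
  proof -
    have "(S ?i t * new_A nb x A t i) *\<^sub>v f i = (S ?i t * new_A nb x A t i) *\<^sub>v f' i"
    proof (rule parity_check_isolate[OF nA[OF t] S[OF ib t] t i f f'])
      fix j assume j: "j < n" "j \<noteq> i"
      show "(S ?i t * new_A nb x A t j) *\<^sub>v f j = (S ?i t * new_A nb x A t j) *\<^sub>v f' j"
      proof (cases "j mod nb = ?i")
        case True
        \<comment> \<open>Within the residue class of \<open>i\<close> the repair matrix is the
          identity, so the contents themselves agree.\<close>
        with all[OF j] car[OF j(1)] have "f j = f' j" by (simp add: new_R_def)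
        thus ?thesis by simp
      next
        case False
        let ?j = "j mod nb"
        have jb: "?j < nb" using nb by simp
        have Rij: "R ?i ?j \<in> carrier_mat \<beta> N" using R ib jb False by simp
        have "R ?i ?j *\<^sub>v f j = R ?i ?j *\<^sub>v f' j"
          using all[OF j] False by (simp add: new_R_def)
        hence "f j - f' j \<in> mat_kernel (R ?i ?j)"
          using minus_in_mat_kernel_iff[OF Rij car[OF j(1)]] by simp
        moreover have "mat_rank (stack_mats N [R ?i ?j, S ?i t * A t ?j]) = mat_rank (R ?i ?j)"
          using R2 ib jb False t unfolding R2_def by metis
        ultimately have "f j - f' j \<in> mat_kernel (S ?i t * A t ?j)"
          using mat_kernel_stack_absorb[OF Rij SA[OF t]] by blast
        hence "(S ?i t * A t ?j) *\<^sub>v f j = (S ?i t * A t ?j) *\<^sub>v f' j"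
          using minus_in_mat_kernel_iff[OF SA[OF t] car[OF j(1)]] by simp
        thus ?thesis using car[OF j(1)] t by (simp add: mult smult)
      qed
    qed
    hence eq: "x t i \<cdot>\<^sub>v ((S ?i t * A t ?i) *\<^sub>v f i) = x t i \<cdot>\<^sub>v ((S ?i t * A t ?i) *\<^sub>v f' i)"
      using car[OF i] t by (simp add: mult smult)
    \<comment> \<open>The scalar of the failed node itself has to be cancelled, which is possible
      because it is nonzero.\<close>
    have "inverse (x t i) * x t i = 1" using x[OF t i] by simp
    hence "(S ?i t * A t ?i) *\<^sub>v f i = (S ?i t * A t ?i) *\<^sub>v f' i"
      using arg_cong[OF eq, of "\<lambda>v. inverse (x t i) \<cdot>\<^sub>v v"] by (simp add: smult_smult_assoc)
    thus ?thesis
      using minus_in_mat_kernel_iff[OF SA[OF t] car[OF i]] by simp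
  qed
  let ?Ms = "map (\<lambda>t. S ?i t * A t ?i) [0..<r]"
  \<comment> \<open>The difference is killed by every block of the R1 stack, whose kernel is trivial
    by full rank.\<close>
  have "f i - f' i \<in> mat_kernel (stack_mats N ?Ms)"
    by (subst mat_kernel_stack_mats)
      (use carrier_matD(2)[OF A[OF _ ib]] zero car[OF i] in auto)
  moreover have "mat_rank (stack_mats N ?Ms) = N"
    using R1 ib unfolding R1_def by blast
  ultimately have "f i - f' i = 0\<^sub>v N"
    using mat_kernel_full_rank[OF stack_mats_carrier] by blast
  thus "f i = f' i"
    using car[OF i] by (auto simp: vec_eq_iff)
qed

theorem theorem2:
  fixes A R S :: "nat \<Rightarrow> nat \<Rightarrow> 'a::{field,finite} mat"
    and x :: "nat \<Rightarrow> nat \<Rightarrow> 'a"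
    and nb kb db N r s n k d dc :: nat
  assumes r: "r = nb - kb"
    and A: "\<And>t i. t < r \<Longrightarrow> i < nb \<Longrightarrow> A t i \<in> carrier_mat N N"
    and base: "MSR_code nb kb N db (array_code nb r N A)"
    and db: "db < nb - 1"
    and dvd: "(db - kb + 1) dvd N"
    and R: "MSR_repair_matrices nb kb N db (array_code nb r N A) R"
    and S: "MSR_select_matrices nb kb r N db S"
    and s: "s \<ge> 2"
    and n: "n = s * nb"
    and k: "k = n - r"
    and d: "d = n - nb + db"
    and dc: "dc = s - 1"
    and x: "\<And>t j. t < r \<Longrightarrow> j < n \<Longrightarrow> x t j \<noteq> 0"
    and R1: "R1 nb r N A S"
    and R2: "R2 nb r N A R S"
    and R3: "R3 nb n d (array_code n r N (new_A nb x A)) (new_R nb N R)"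
  shows "repair_property n d dc (compulsory nb n) (array_code n r N (new_A nb x A)) \<and>
         has_optimal_repair_bandwidth (1 + real dc * (real d - real k) / real d) n k N d
           (compulsory nb n) (array_code n r N (new_A nb x A)) (new_R nb N R)"
proof -
  let ?C = "array_code n r N (new_A nb x A)"
  define e where "e = db - kb + 1"
  have nb: "nb > 0" using db by simp
  have kb: "kb \<le> db" using base by (simp add: MSR_code_def)
  have det: "determined_by ?C H (\<lambda>j v. new_R nb N R i j *\<^sub>v v) (\<lambda>f. f i)"
    if "i < n" "H \<subseteq> {0..<n} - {i}" "card H = d" "compulsory nb n i \<subseteq> H" for i H
    by (rule new_code_repair[OF nb A _ _ x R1 R2 R3 that])
      (use R S in \<open>auto simp: MSR_repair_matrices_def MSR_select_matrices_def\<close>)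
  have rank: "mat_rank (R i j) = N div e" if "i < nb" "j < nb" "j \<noteq> i" for i j
    using R that by (simp add: MSR_repair_matrices_def e_def)
  \<comment> \<open>At least two copies of the base code give \<open>n - nb > 0\<close>, hence
    \<open>d > 0\<close>, and keep the natural-number subtractions from truncating.\<close>
  have "nb * 2 \<le> n" using s by (simp add: n)
  hence k': "k = n - nb + kb" and "nb \<le> n" and d0: "d > 0"
    using k r kb db d nb by linarith+
  \<comment> \<open>Lengthening the code shifts \<open>k\<close> and \<open>d\<close> by the same
    amount \<open>n - nb\<close>, so \<open>e\<close> is also \<open>d - k + 1\<close>.\<close>
  hence dk: "real d - real k = real e - 1"
    using d kb by (simp add: e_def of_nat_diff)
  \<comment> \<open>With \<open>N = e * b\<close>, both sides equal
    \<open>dc * e * b + (d - dc) * b\<close>: on the right, \<open>(d + dc * (e - 1)) / e\<close> is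
    multiplied by \<open>e * b\<close>.\<close>
  have band: "real (\<Sum>j\<in>H. mat_rank (new_R nb N R i j)) =
      (1 + real dc * (real d - real k) / real d) * opt_bandwidth k d N"
    if i: "i < n" and H: "H \<subseteq> {0..<n} - {i}" "card H = d" "compulsory nb n i \<subseteq> H" for i H
  proof -
    have "card (compulsory nb n i) \<le> card H"
      by (rule card_mono[OF finite_subset[OF H(1)] H(3)]) simp
    \<comment> \<open>Ensures that \<open>d - dc\<close> is a true difference when it is cast to the
      reals.\<close>
    hence dcd: "dc \<le> d"
      using card_compulsory[OF nb, of i s] i H(2) by (simp add: n dc)
    obtain b where b: "N = e * b" using dvd by (auto simp: e_def)
    have e0: "e > 0" by (simp add: e_def)
    have "(\<Sum>j\<in>H. mat_rank (new_R nb N R i j)) = dc * N + (d - dc) * b"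
      using sum_mat_rank_new_R[OF nb n i H rank] e0 by (simp add: dc b)
    thus ?thesis
      unfolding opt_bandwidth_def dk using dcd e0 d0
      by (simp add: b of_nat_diff field_simps)
  qed
  have cs: "compulsory nb n i \<subseteq> {0..<n} - {i}" for i
    by (auto simp: compulsory_def)
  show ?thesis
    unfolding repair_property_def has_optimal_repair_bandwidth_def
    using det band cs card_compulsory[OF nb, of _ s] by (auto simp: n dc)
qed

end
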